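(* Let $n\ge 2$ be an integer and write $n=\sum_{i=a}^{e} n_i\cdot 2^i$ with $0\le n_i\le 1$ integers for all $i$ and $n_a\neq 0\neq n_e$. Let $w(n)$ be the coefficient of $q^n$ in the formal power series $$\sum_{i\ge 2} q^{2^{i-1}}\bigl(1+q^{2^{i-2}}\bigr)\frac{1}{(1-q)\prod_{j=0}^{i-3}(1-q^{2^j})}.$$ If $a=e$ (i.e., if $n$ is a power of $2$), then $$w(n)\equiv 2\left\lfloor a/2\right\rfloor+1 \pmod 8.$$ Otherwise, $$\begin{aligned} w(n)\equiv{}& 2+2\left\lfloor a/2\right\rfloor+2\chi(a\text{ even})(1-2n_{a+1})(e-a-1)+4\chi(a\text{ odd})(e-a)\\ &+4\chi(a\text{ even})\left(e\sum_{i=a+2}^{e-\chi(e\text{ even})} n_i + a\cdot n_{a+2}+\sum_{t=\frac12(a+4)}^{\left\lfloor \frac12(e+1)\right\rfloor} n_{2t-1}\right)\pmod 8. \end{aligned}$$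
   Context: For a statement $\mathcal S$, $\chi(\mathcal S)=1$ if $\mathcal S$ is true and $\chi(\mathcal S)=0$ otherwise. Binary digits outside the range $a\le i\le e$ are $0$, i.e. $n_i=0$ for $i<a$ or $i>e$. Empty products equal $1$ (so the $i=2$ summand of the generating function is $q^2(1+q)/(1-q)$). Sums are interpreted by the convention that $\sum_{k=M}^{N-1}\mathrm{Expr}(k)$ is the usual sum if $N>M$, is $0$ if $N=M$, and is $-\sum_{k=N}^{M-1}\mathrm{Expr}(k)$ if $N<M$. Terms multiplied by $\chi(a\text{ even})$ are taken to be $0$ when $a$ is odd. Background: if $u(m)$ denotes the number of unique path partitions of $m$, whose generating function is $\sum_{m\ge1}u(m)q^m=2\sum_{i\ge1}q^{2^i-1}(1+q^{2^{i-1}})\prod_{j=0}^{i-2}\frac{1}{1-q^{2^j}}$, then $2w(n)=u(2n)=u(2n-1)$ for $n\ge 2$, so the result determines $u$ modulo $16$. *)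

theory Defs
  imports Complex_Main "HOL-Number_Theory.Cong" "HOL-Computational_Algebra.Formal_Power_Series"
begin

(* The infinite sum is the limit in the fps topology (coefficientwise stabilisation).  The summand
   at index k is the one for i = k + 2.  Coefficients are rational because the library has
   division of power series only over a field. *)
definition gen_fun :: "rat fps" where
  "gen_fun = (\<Sum>k. let i = k + 2 in
     fps_X ^ (2 ^ (i - 1)) * (1 + fps_X ^ (2 ^ (i - 2))) *
     (1 / ((1 - fps_X) * (\<Prod>j<i - 2. 1 - fps_X ^ (2 ^ j)))))"

definition w :: "nat \<Rightarrow> rat" where
  "w n = fps_nth gen_fun n"

(* The convention for sums over k = M, ..., N - 1 of arbitrary integer bounds, with m = M and
   u = N - 1: for N < M it is minus the sum over k = N, ..., M - 1. *)
definition signed_sum :: "int \<Rightarrow> int \<Rightarrow> (int \<Rightarrow> int) \<Rightarrow> int" where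
  "signed_sum m u f =
     (if m \<le> u + 1 then (\<Sum>k\<in>{m..u}. f k) else - (\<Sum>k\<in>{u + 1..m - 1}. f k))"

end

theory Submission
  imports Defs
begin

text \<open>The generating function satisfies \<open>(1 - q) G(q) = (1 + q) (q\<^sup>2 + G(q\<^sup>2))\<close>.
  Setting \<open>S(m) = 1 + \<Sum>\<^bsub>2\<le>j\<le>m\<^esub> w(j)\<close> for \<open>m \<ge> 1\<close> and \<open>S(0) = 0\<close>, this says
  \<open>w(n) = S(\<lfloor>n/2\<rfloor>) + S(\<lfloor>(n-1)/2\<rfloor>)\<close>. Modulo 4 it implies \<open>S(2m) \<equiv> 1 + S(m)\<close> (for \<open>m \<ge> 1\<close>)
  and \<open>S(2m+1) \<equiv> 1 - S(m)\<close>, so \<open>S(m)\<close> modulo 4 can be read off from the binary digits of \<open>m\<close>,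
  and \<open>w(2\<^sup>a (2m+1))\<close> modulo 8 from \<open>a\<close> and \<open>S(m)\<close> modulo 4.\<close>

text \<open>The function \<open>S\<close> of the overview. The last two summands are
  \<open>S\<close> at \<open>(n + 2) div 2\<close> and \<open>(n + 1) div 2\<close>, together
  \<open>w(n + 2)\<close>, which makes the recursion self-contained.\<close>

fun wsum :: "nat \<Rightarrow> int" where
  "wsum 0 = 0"
| "wsum (Suc 0) = 1"
| "wsum (Suc (Suc n)) = wsum (Suc n) + wsum (Suc (n div 2)) + wsum (Suc n div 2)"

definition wint :: "nat \<Rightarrow> int" where
  "wint n = wsum (n div 2) + wsum ((n - 1) div 2)"

text \<open>The correction is the constant 1 in \<open>S\<close>: it enters at
  \<open>S(1) = 1\<close>, while \<open>wint 1 = 0\<close>.\<close>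

lemma wsum_Suc: "wsum (Suc n) = wsum n + wint (Suc n) + of_bool (n = 0)"
  by (cases n) (simp_all add: wint_def)

lemma wint_odd: "wint (2 * m + 1) = 2 * wsum m"
  by (simp add: wint_def)

lemma wint_double:
  assumes "m > 0"
  shows "wint (2 * m) = 2 * wsum (m - 1) + wint m + of_bool (m = 1)"
proof -
  obtain k where k: "m = Suc k" using assms by (cases m) auto
  have "wint (2 * m) = wsum (Suc k) + wsum k"
    by (simp add: wint_def k)
  then show ?thesis by (simp add: k wsum_Suc)
qed

subsection \<open>The generating function\<close>

lemma fps_nth_compose_X_square:
  fixes f :: "'a::comm_ring_1 fps"
  shows "fps_nth (f oo fps_X ^ 2) n = (if even n then fps_nth f (n div 2) else 0)"
proof -
  have "fps_nth (f oo fps_X ^ 2) n = (\<Sum>i=0..n. if n = 2 * i then fps_nth f i else 0)"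
    unfolding fps_compose_nth
    by (intro sum.cong) (auto simp flip: power_mult)
  also have "\<dots> = (\<Sum>i\<in>{i. n = 2 * i}. fps_nth f i)"
    by (intro sum.mono_neutral_cong_right) auto
  also have "{i. n = 2 * i} = (if even n then {n div 2} else {})"
    by auto
  finally show ?thesis by simp
qed

lemma fps_X_power_compose_X_square:
  "(fps_X ^ n oo fps_X ^ 2 :: 'a::idom fps) = fps_X ^ (2 * n)"
  by (simp add: fps_X_power_compose power_mult)

definition gen_term :: "nat \<Rightarrow> rat fps" where
  "gen_term k = fps_X ^ (2 ^ Suc k) * (1 + fps_X ^ (2 ^ k)) *
     (1 / ((1 - fps_X) * (\<Prod>j<k. 1 - fps_X ^ (2 ^ j))))"

lemma gen_fun_eq: "gen_fun = (\<Sum>k. gen_term k)"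
  by (simp add: gen_fun_def gen_term_def Let_def)

text \<open>Substituting \<open>q^2\<close> for \<open>q\<close> doubles every exponent and turns
  the numerator into the next one. The denominator acquires \<open>1 - q^2 = (1 + q) (1 - q)\<close>
  where the next term has \<open>(1 - q)^2\<close>.\<close>

lemma gen_term_Suc:
  "(1 - fps_X) * gen_term (Suc k) = (1 + fps_X) * (gen_term k oo fps_X ^ 2)"
proof -
  define D :: "nat \<Rightarrow> rat fps" where "D k = (1 - fps_X) * (\<Prod>j<k. 1 - fps_X ^ (2 ^ j))" for k
  define N :: "nat \<Rightarrow> rat fps" where "N k = fps_X ^ (2 ^ Suc k) * (1 + fps_X ^ (2 ^ k))" for k
  have D0: "fps_nth (D k) 0 = 1" for k
    unfolding D_def by (induction k) (simp_all add: mult_ac)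
  then have Dnz: "D k \<noteq> 0" for k
    by (metis fps_zero_nth zero_neq_one)
  have "gen_term k = N k * inverse (D k)" for k
    using D0[of k] unfolding gen_term_def N_def[symmetric] D_def[symmetric]
    by (simp add: fps_divide_unit)
  \<comment> \<open>With denominators cleared, the claim can be checked after multiplication by the
    nonzero \<open>D (Suc k)\<close>.\<close>
  then have term_D: "gen_term k * D k = N k" for k
    using D0[of k] by (simp add: mult.assoc inverse_mult_eq_1)
  have X2: "fps_nth (fps_X ^ 2 :: rat fps) 0 = 0" by simp
  have D_comp: "(1 + fps_X) * D (Suc k) = (1 - fps_X) * (D k oo fps_X ^ 2)"
  proof -
    have "D k oo fps_X ^ 2 = (1 - fps_X ^ 2) * (\<Prod>j<k. 1 - fps_X ^ (2 ^ Suc j))"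
      unfolding D_def
      by (simp add: fps_compose_mult_distrib[OF X2] fps_compose_prod_distrib[OF X2]
          fps_compose_sub_distrib fps_X_power_compose_X_square fps_X_fps_compose_startby0)
    moreover have "D (Suc k) = (1 - fps_X) * ((1 - fps_X) * (\<Prod>j<k. 1 - fps_X ^ (2 ^ Suc j)))"
      unfolding D_def prod.lessThan_Suc_shift by simp
    moreover have "1 - fps_X ^ 2 = (1 + fps_X) * (1 - fps_X :: rat fps)"
      by (simp add: power2_eq_square algebra_simps)
    ultimately show ?thesis
      by (simp only: mult_ac)
  qed
  have N_comp: "N k oo fps_X ^ 2 = N (Suc k)"
    unfolding N_def
    by (simp add: fps_compose_mult_distrib[OF X2] fps_compose_add_distrib
        fps_X_power_compose_X_square)
  have "(1 + fps_X) * (gen_term k oo fps_X ^ 2) * D (Suc k)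
      = (1 - fps_X) * ((gen_term k oo fps_X ^ 2) * (D k oo fps_X ^ 2))"
    using D_comp by (metis mult.assoc mult.left_commute)
  also have "\<dots> = (1 - fps_X) * N (Suc k)"
    by (simp only: fps_compose_mult_distrib[OF X2, symmetric] term_D N_comp)
  also have "\<dots> = (1 - fps_X) * gen_term (Suc k) * D (Suc k)"
    by (simp only: term_D mult.assoc)
  finally show ?thesis
    using Dnz[of "Suc k"] by simp
qed

lemma gen_term_0: "(1 - fps_X) * gen_term 0 = (1 + fps_X) * fps_X ^ 2"
proof -
  have "inverse (1 - fps_X :: rat fps) * (1 - fps_X) = 1"
    by (rule inverse_mult_eq_1) simp
  then have "(1 - fps_X) * (1 / (1 - fps_X :: rat fps)) = 1"
    by (simp add: fps_divide_unit mult.commute)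
  then show ?thesis
    by (simp add: gen_term_def mult_ac)
qed

definition wfps :: "rat fps" where
  "wfps = Abs_fps (\<lambda>n. of_int (wint n))"

text \<open>At \<open>n > 0\<close> the left coefficient is \<open>wint n - wint (n - 1)\<close>;
  the right one is \<open>wint (n div 2)\<close>, plus 1 at \<open>n = 2\<close> and
  \<open>n = 3\<close> from \<open>(1 + q) q^2\<close>.\<close>

lemma wfps_functional_equation:
  "(1 - fps_X) * wfps = (1 + fps_X) * (fps_X ^ 2 + (wfps oo fps_X ^ 2))"
proof (rule fps_ext)
  fix n
  have "n = 0 \<or> (\<exists>m. n = Suc (2 * m)) \<or> (\<exists>m. n = Suc (Suc (2 * m)))"
    by presburger
  then show "fps_nth ((1 - fps_X) * wfps) n
      = fps_nth ((1 + fps_X) * (fps_X ^ 2 + (wfps oo fps_X ^ 2))) n"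
  proof (elim disjE exE)
    assume "n = 0"
    then show ?thesis by (simp add: wfps_def wint_def fps_nth_compose_X_square)
  next
    fix m assume n: "n = Suc (2 * m)"
    have "wint (Suc (2 * m)) - wint (2 * m) = wint m + of_bool (m = 1)"
      using wint_odd[of m] wint_double[of m] wsum_Suc[of "m - 1"]
      by (cases m) (simp_all add: wint_def[of 0])
    then have "(of_int (wint (Suc (2 * m))) - of_int (wint (2 * m)) :: rat)
        = of_int (wint m + of_bool (m = 1))"
      by (metis of_int_diff)
    then show ?thesis
      by (auto simp: n wfps_def ring_distribs fps_nth_compose_X_square)
  next
    fix m assume n: "n = Suc (Suc (2 * m))"
    have "wint (Suc (Suc (2 * m))) - wint (Suc (2 * m)) = wint (Suc m) + of_bool (m = 0)"
      using wint_odd[of m] wint_double[of "Suc m"] by simp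
    then have "(of_int (wint (Suc (Suc (2 * m)))) - of_int (wint (Suc (2 * m))) :: rat)
        = of_int (wint (Suc m) + of_bool (m = 0))"
      by (metis of_int_diff)
    then show ?thesis
      by (auto simp: n wfps_def ring_distribs fps_nth_compose_X_square)
  qed
qed

text \<open>The remainders \<open>R N\<close> satisfy the homogeneous equation
  \<open>(1 - q) R(N+1)(q) = (1 + q) R(N)(q^2)\<close>, so the range of vanishing coefficients
  doubles with each step.\<close>

lemma gen_term_partial_sum_nth:
  assumes "n < 2 ^ Suc N"
  shows "fps_nth (\<Sum>k<N. gen_term k) n = of_int (wint n)"
proof -
  define R where "R N = wfps - (\<Sum>k<N. gen_term k)" for N
  have step: "(1 - fps_X) * R (Suc N) = (1 + fps_X) * (R N oo fps_X ^ 2)" for N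
  proof -
    have "(1 - fps_X) * (\<Sum>k<Suc N. gen_term k)
        = (1 + fps_X) * (fps_X ^ 2 + ((\<Sum>k<N. gen_term k) oo fps_X ^ 2))"
      by (simp only: sum.lessThan_Suc_shift distrib_left gen_term_0 gen_term_Suc
          sum_distrib_left fps_compose_sum_distrib)
    then show ?thesis
      by (simp add: R_def right_diff_distrib wfps_functional_equation fps_compose_sub_distrib
          distrib_left del: sum.lessThan_Suc)
  qed
  have "fps_nth (R N) n = 0" if "n < 2 ^ Suc N" for n N
    using that
  proof (induction N arbitrary: n)
    case 0
    then have "n = 0 \<or> n = 1" by auto
    then show ?case by (auto simp: R_def wfps_def wint_def)
  next
    case (Suc N)
    have comp: "fps_nth (R N oo fps_X ^ 2) m = 0" if "m < 2 ^ Suc (Suc N)" for m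
      using that Suc.IH[of "m div 2"] by (simp add: fps_nth_compose_X_square)
    \<comment> \<open>Vanishing coefficients of \<open>(1 - q) R\<close> make consecutive
      coefficients of \<open>R\<close> equal, starting from zero.\<close>
    show ?case using Suc.prems
    proof (induction n)
      case 0
      have "fps_nth ((1 - fps_X) * R (Suc N)) 0 = 0"
        unfolding step using comp[of 0] by simp
      then show ?case by simp
    next
      case (Suc n)
      have "fps_nth ((1 - fps_X) * R (Suc N)) (Suc n) = 0"
        unfolding step using comp[of n] comp[of "Suc n"] Suc.prems by (simp add: ring_distribs)
      then show ?case using Suc by (simp add: ring_distribs)
    qed
  qed
  from this[OF assms] show ?thesis by (simp add: R_def wfps_def)
qed

text \<open>Coefficient \<open>n\<close> of the partial sums is stable from \<open>N = n\<close> on,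
  because \<open>n < 2 ^ Suc N\<close>.\<close>

lemma w_eq_wint: "w n = of_int (wint n)"
proof -
  have "gen_term sums wfps"
    unfolding sums_def
  proof (rule tendsto_fpsI)
    fix n
    show "\<forall>\<^sub>F N in sequentially. fps_nth (sum gen_term {..<N}) n = fps_nth wfps n"
      using eventually_ge_at_top[of n]
    proof eventually_elim
      case (elim N)
      have "n < 2 ^ Suc N"
        using elim less_exp[of N] unfolding power_Suc by linarith
      then show ?case
        by (simp add: gen_term_partial_sum_nth wfps_def)
    qed
  qed
  then show ?thesis
    by (simp add: w_def gen_fun_eq sums_iff wfps_def)
qed

subsection \<open>Congruences\<close>

text \<open>Passing from \<open>2m + 1\<close> to \<open>2m + 3\<close> adds
  \<open>S(m) + 3 S(m+1)\<close>, which is \<open>S(m) - S(m+1)\<close> modulo 4.\<close>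

lemma wsum_odd_cong: "[wsum (2 * m + 1) = 1 - wsum m] (mod 4)"
proof (induction m)
  case (Suc m)
  have "wsum (2 * Suc m + 1) = wsum (2 * m + 1) + wsum m + 3 * wsum (Suc m)"
    by simp
  with Suc show ?case unfolding cong_iff_dvd_diff by presburger
qed simp

lemma wsum_even_cong:
  assumes "m > 0"
  shows "[wsum (2 * m) = 1 + wsum m] (mod 4)"
proof -
  have "wsum (2 * m + 1) = wsum (2 * m) + 2 * wsum m"
    using assms wsum_Suc[of "2 * m"] wint_odd[of m] by simp
  with wsum_odd_cong[of m] show ?thesis unfolding cong_iff_dvd_diff by presburger
qed

lemma wsum_cong:
  assumes "m > 0" "b \<in> {0, 1}"
  shows "[wsum (2 * m + b) = 1 + (1 - 2 * int b) * wsum m] (mod 4)"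
  using assms wsum_even_cong[of m] wsum_odd_cong[of m] by auto

section \<open>Dependence on the power of two dividing the argument\<close>

text \<open>Raising \<open>t\<close> by one replaces \<open>x\<close> by \<open>2x + 1\<close>,
  hence \<open>S(x)\<close> by \<open>1 - S(x)\<close>. This is an involution, so the values
  alternate, starting from \<open>S(2m)\<close>.\<close>

lemma wsum_pow2_mult_pred:
  "[wsum (2 ^ t * (2 * m + 1) - 1) =
     (if m = 0 then of_bool (odd t) else if even t then 1 + wsum m else - wsum m)] (mod 4)"
proof (induction t)
  case 0
  show ?case using wsum_even_cong[of m] by simp
next
  case (Suc t)
  let ?x = "2 ^ t * (2 * m + 1) - 1"
  have "2 ^ Suc t * (2 * m + 1) - 1 = 2 * ?x + 1"
    by (cases "2 ^ t * (2 * m + 1)") (simp_all only: power_Suc mult.assoc, simp_all)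
  then have "[wsum (2 ^ Suc t * (2 * m + 1) - 1) = 1 - wsum ?x] (mod 4)"
    by (metis wsum_odd_cong)
  also have "[1 - wsum ?x = 1 - (if m = 0 then of_bool (odd t)
      else if even t then 1 + wsum m else - wsum m)] (mod 4)"
    by (intro cong_diff cong_refl Suc.IH)
  finally show ?case
    by (auto split: if_splits)
qed

lemma cong_double_mod8:
  fixes x y :: int
  assumes "[x = y] (mod 4)"
  shows "[2 * x = 2 * y] (mod 8)"
  using assms unfolding cong_iff_dvd_diff by presburger

text \<open>By \<open>wint_double\<close>, going from \<open>a\<close> to \<open>a + 1\<close> adds
  \<open>2 + 2 S(m)\<close> for even \<open>a\<close> and \<open>- 2 S(m)\<close> for odd
  \<open>a\<close>; two successive steps add 2.\<close>

lemma wint_pow2_mult: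
  assumes "m > 0"
  shows "[wint (2 ^ a * (2 * m + 1)) =
     2 * (int a div 2) + (if even a then 2 * wsum m else 2 + 4 * wsum m)] (mod 8)"
proof (induction a)
  case 0
  show ?case using wint_odd[of m] by simp
next
  case (Suc a)
  let ?x = "2 ^ a * (2 * m + 1)"
  have "?x \<noteq> 1" using assms by (simp del: mult_Suc_right)
  then have "wint (2 ^ Suc a * (2 * m + 1)) = 2 * wsum (?x - 1) + wint ?x"
    using wint_double[of ?x] by (simp add: mult.assoc)
  moreover have "[2 * wsum (?x - 1) = 2 * (if even a then 1 + wsum m else - wsum m)] (mod 8)"
    using wsum_pow2_mult_pred[of a m] assms by (intro cong_double_mod8) simp
  ultimately have "[wint (2 ^ Suc a * (2 * m + 1)) =
      2 * (if even a then 1 + wsum m else - wsum m)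
      + (2 * (int a div 2) + (if even a then 2 * wsum m else 2 + 4 * wsum m))] (mod 8)"
    using cong_add[OF _ Suc.IH] by presburger
  then show ?case
    by (cases "even a") (auto elim!: evenE oddE simp: algebra_simps)
qed

text \<open>The induction starts at \<open>wint 2 = 1\<close>; going from \<open>a\<close> to
  \<open>a + 1\<close> adds 2 exactly when \<open>a\<close> is odd.\<close>

lemma wint_pow2:
  assumes "a > 0"
  shows "[wint (2 ^ a) = 2 * (int a div 2) + 1] (mod 8)"
  using assms
proof (induction a rule: nat_induct_non_zero)
  case 1
  show ?case by (simp add: wint_def)
next
  case (Suc a)
  have "wint (2 ^ Suc a) = 2 * wsum (2 ^ a - 1) + wint (2 ^ a)"
    using wint_double[of "2 ^ a"] Suc.hyps by simp
  moreover have "[2 * wsum (2 ^ a - 1) = 2 * of_bool (odd a)] (mod 8)"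
    using wsum_pow2_mult_pred[of a 0] by (intro cong_double_mod8) simp
  ultimately have "[wint (2 ^ Suc a) = 2 * of_bool (odd a) + (2 * (int a div 2) + 1)] (mod 8)"
    using cong_add[OF _ Suc.IH] by presburger
  then show ?case
    by (cases "even a") (auto elim!: evenE oddE simp: algebra_simps)
qed

section \<open>Reading \<open>S\<close> modulo 4 from binary digits\<close>

lemma binary_value_Suc:
  fixes b :: "nat \<Rightarrow> nat"
  assumes "k < e"
  shows "(\<Sum>i=k..e. b i * 2 ^ (i - k)) = 2 * (\<Sum>i=Suc k..e. b i * 2 ^ (i - Suc k)) + b k"
proof -
  have "(\<Sum>i=k..e. b i * 2 ^ (i - k)) = b k + (\<Sum>i=Suc k..e. b i * 2 ^ (i - k))"
    using assms by (simp add: sum.atLeast_Suc_atMost)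
  also have "(\<Sum>i=Suc k..e. b i * 2 ^ (i - k)) = 2 * (\<Sum>i=Suc k..e. b i * 2 ^ (i - Suc k))"
    unfolding sum_distrib_left
    by (intro sum.cong) (auto simp: Suc_diff_le mult_ac simp flip: power_Suc)
  finally show ?thesis by simp
qed

lemma binary_value_pos:
  fixes b :: "nat \<Rightarrow> nat"
  assumes "k \<le> e" and "b e = 1"
  shows "(\<Sum>i=k..e. b i * 2 ^ (i - k)) > 0"
proof -
  have "b e * 2 ^ (e - k) \<le> (\<Sum>i=k..e. b i * 2 ^ (i - k))"
    using assms by (intro member_le_sum) auto
  then show ?thesis
    using assms(2) by (metis mult_1 less_le_trans zero_less_numeral zero_less_power)
qed

text \<open>Digits are read from the leading one, where \<open>S(1) = 1\<close>. Each further digit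
  adds 1, and a digit 1 at position \<open>i\<close> also negates, that is, subtracts twice a number
  congruent to \<open>e - i\<close> modulo 2.\<close>

lemma wsum_digits_cong:
  fixes b :: "nat \<Rightarrow> nat"
  assumes "k \<le> e" and "\<And>i. b i \<in> {0, 1}" and "b e = 1"
  shows "[wsum (\<Sum>i=k..e. b i * 2 ^ (i - k)) =
     int (e - k) + 1 + 2 * (\<Sum>i=k..<e. int (b i) * int (e - i))] (mod 4)"
  using assms(1)
proof (induction k rule: inc_induct)
  case base
  show ?case using assms(3) by simp
next
  case (step k)
  let ?q = "\<lambda>k. \<Sum>i=k..e. b i * 2 ^ (i - k)"
  let ?s = "\<lambda>k. \<Sum>i=k..<e. int (b i) * int (e - i)"
  have q: "?q k = 2 * ?q (Suc k) + b k"
    using step by (intro binary_value_Suc)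
  have pos: "?q (Suc k) > 0"
    using step assms(3) by (intro binary_value_pos) auto
  have s: "?s k = int (b k) * int (e - k) + ?s (Suc k)"
    using step by (simp add: sum.atLeast_Suc_lessThan)
  have e: "int (e - k) = int (e - Suc k) + 1" using step by simp
  have "[wsum (2 * ?q (Suc k) + b k) = 1 + (1 - 2 * int (b k)) * wsum (?q (Suc k))] (mod 4)"
    by (rule wsum_cong[OF pos assms(2)])
  also have "[1 + (1 - 2 * int (b k)) * wsum (?q (Suc k))
      = 1 + (1 - 2 * int (b k)) * (int (e - k) + 2 * ?s (Suc k))] (mod 4)"
    using step.IH by (intro cong_add cong_mult cong_refl) (simp add: e)
  \<comment> \<open>Modulo 4 the product of the two doubled terms vanishes and the sign of
    \<open>2 * int (b k) * int (e - k)\<close> is immaterial.\<close>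
  also have "[1 + (1 - 2 * int (b k)) * (int (e - k) + 2 * ?s (Suc k))
      = int (e - k) + 1 + 2 * (int (b k) * int (e - k) + ?s (Suc k))] (mod 4)"
    unfolding cong_iff_dvd_diff by (simp add: algebra_simps)
  finally show ?case
    unfolding q s .
qed

section \<open>Signed sums, parities and arithmetic modulo 8\<close>

lemma signed_sum_nat:
  assumes "l \<le> u"
  shows "signed_sum (int l) (int u - 1) f = (\<Sum>i=l..<u. f (int i))"
proof -
  have "{int l..int u - 1} = int ` {l..<u}"
    by (auto simp: image_int_atLeastLessThan)
  then show ?thesis
    using assms by (simp add: signed_sum_def sum.reindex)
qed

text \<open>The weight \<open>e - i\<close> has the parity of \<open>e\<close> at even
  \<open>i\<close> and of \<open>e + 1\<close> at odd \<open>i\<close>, so odd positions contribute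
  one extra copy of their digit. The induction adds positions in pairs.\<close>

lemma digit_sum_parity:
  fixes d :: "nat \<Rightarrow> int" and e :: int
  assumes "Suc b \<le> c"
  shows "[(\<Sum>i=2*b+2..<2*c. d i * (e - int i)) =
    e * (\<Sum>i=2*b+2..<2*c. d i) + (\<Sum>t=b+1..<c. d (2 * t + 1))] (mod 2)"
  using assms
proof (induction c rule: dec_induct)
  case (step c)
  have "[(\<Sum>i=2*b+2..<2*Suc c. d i * (e - int i)) =
      (\<Sum>i=2*b+2..<2*c. d i * (e - int i)) + (e * d (2 * c) + e * d (2 * c + 1) + d (2 * c + 1))]
      (mod 2)"
    using step unfolding cong_iff_dvd_diff by (simp add: algebra_simps)
  also have "[(\<Sum>i=2*b+2..<2*c. d i * (e - int i))
        + (e * d (2 * c) + e * d (2 * c + 1) + d (2 * c + 1))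
      = e * (\<Sum>i=2*b+2..<2*c. d i) + (\<Sum>t=b+1..<c. d (2 * t + 1))
      + (e * d (2 * c) + e * d (2 * c + 1) + d (2 * c + 1))] (mod 2)"
    by (intro cong_add step.IH cong_refl)
  finally show ?case using step by (simp add: algebra_simps)
qed simp

text \<open>Doubling lifts the congruence for \<open>s\<close> to modulus 8, where
  \<open>4xk\<close> and \<open>-4xk\<close> agree; this yields the factor \<open>1 - 2x\<close>.
  Only the parity of \<open>U\<close> matters.\<close>

lemma cong_mod8_combine:
  fixes w s k x U T A :: int
  assumes "[s = k + 1 + 2 * (x * k + U)] (mod 4)" and "[w = A + 2 * s] (mod 8)"
    and "even (U - T)"
  shows "[w = 2 + A + 2 * (1 - 2 * x) * k + 4 * T] (mod 8)"
proof -
  obtain p where p: "s - (k + 1 + 2 * (x * k + U)) = 4 * p"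
    using assms(1) unfolding cong_iff_dvd_diff by (rule dvdE)
  obtain q where q: "w - (A + 2 * s) = 8 * q"
    using assms(2) unfolding cong_iff_dvd_diff by (rule dvdE)
  obtain r where r: "U - T = 2 * r"
    using assms(3) by (rule dvdE)
  have "w - (2 + A + 2 * (1 - 2 * x) * k + 4 * T) = (w - (A + 2 * s))
      + 2 * (s - (k + 1 + 2 * (x * k + U))) + 4 * (U - T) + 8 * (x * k)"
    by (simp add: algebra_simps)
  also have "\<dots> = 8 * (q + p + r + x * k)"
    unfolding p q r by simp
  finally show ?thesis
    by (simp add: cong_iff_dvd_diff)
qed

section \<open>Assembly from the binary digits of \<open>n\<close>\<close>

text \<open>Since \<open>w\<close> is rational-valued, the congruences concern the integer that
  embeds to \<open>w n\<close>, unique by injectivity of \<open>of_int\<close>.\<close>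

theorem theorem7:
  fixes n a e :: nat and d :: "int \<Rightarrow> int"
  assumes "n \<ge> 2"
    and "int n = (\<Sum>i = a..e. d (int i) * 2 ^ i)"
    and "\<forall>i. 0 \<le> d i \<and> d i \<le> 1"
    and "d (int a) \<noteq> 0" and "d (int e) \<noteq> 0"
    and "\<forall>i. i < int a \<or> int e < i \<longrightarrow> d i = 0"
  shows "\<exists>m::int. w n = of_int m \<and>
    (a = e \<longrightarrow> [m = 2 * (int a div 2) + 1] (mod 8)) \<and>
    (a \<noteq> e \<longrightarrow>
      [m = 2 + 2 * (int a div 2)
         + 2 * of_bool (even a) * (1 - 2 * d (int a + 1)) * (int e - int a - 1)
         + 4 * of_bool (odd a) * (int e - int a)
         + 4 * of_bool (even a) *
             (int e * signed_sum (int a + 2) (int e - of_bool (even e)) d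
              + int a * d (int a + 2)
              + signed_sum ((int a + 4) div 2) ((int e + 1) div 2) (\<lambda>t. d (2 * t - 1)))] (mod 8))"
proof -
  define b where "b i = nat (d (int i))" for i
  have d: "d (int i) = int (b i)" for i
    using assms(3) by (simp add: b_def)
  have b01: "b i \<in> {0, 1}" for i
    using assms(3)[rule_format, of "int i"] by (auto simp: b_def)
  have ba: "b a = 1" and be: "b e = 1"
    using b01[of a] b01[of e] assms(4,5) by (auto simp: d)
  have "a \<le> e"
    using assms(1,2) by (cases "a \<le> e") auto
  have "int n = int (\<Sum>i=a..e. b i * 2 ^ i)"
    using assms(2) by (simp add: d)
  then have "n = (\<Sum>i=a..e. b i * 2 ^ i)"
    by (simp only: of_nat_eq_iff)
  also have "\<dots> = 2 ^ a * (\<Sum>i=a..e. b i * 2 ^ (i - a))"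
    unfolding sum_distrib_left
    by (intro sum.cong) (auto simp: mult.left_commute simp flip: power_add)
  finally have n: "n = 2 ^ a * (\<Sum>i=a..e. b i * 2 ^ (i - a))" .
  show ?thesis
  proof (intro exI[of _ "wint n"] conjI impI)
    show "w n = of_int (wint n)" by (rule w_eq_wint)
  next
    assume "a = e"
    with n be have n2: "n = 2 ^ a" by simp
    with assms(1) have "a > 0" by (cases a) auto
    with n2 show "[wint n = 2 * (int a div 2) + 1] (mod 8)"
      by (simp add: wint_pow2)
  next
    assume "a \<noteq> e"
    with \<open>a \<le> e\<close> have ae: "a < e" by simp
    define m where "m = (\<Sum>i=Suc a..e. b i * 2 ^ (i - Suc a))"
    have "n = 2 ^ a * (2 * m + 1)"
      using n binary_value_Suc[OF ae, of b] ba by (simp add: m_def)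
    moreover have "m > 0"
      unfolding m_def using ae be by (intro binary_value_pos) auto
    ultimately have W: "[wint n = 2 * (int a div 2)
        + (if even a then 2 * wsum m else 2 + 4 * wsum m)] (mod 8)"
      using wint_pow2_mult by blast
    have S: "[wsum m = int (e - Suc a) + 1
        + 2 * (\<Sum>i=Suc a..<e. int (b i) * int (e - i))] (mod 4)"
      unfolding m_def using ae be b01 by (intro wsum_digits_cong) auto
    let ?T = "int e * signed_sum (int a + 2) (int e - of_bool (even e)) d
              + int a * d (int a + 2)
              + signed_sum ((int a + 4) div 2) ((int e + 1) div 2) (\<lambda>t. d (2 * t - 1))"
    show "[wint n = 2 + 2 * (int a div 2)
         + 2 * of_bool (even a) * (1 - 2 * d (int a + 1)) * (int e - int a - 1)
         + 4 * of_bool (odd a) * (int e - int a) + 4 * of_bool (even a) * ?T] (mod 8)"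
    proof (cases "even a")
      case False
      \<comment> \<open>For odd \<open>a\<close>, \<open>S(m)\<close> enters with factor 4, so only
        its parity counts, and this depends only on the number of digits of
        \<open>m\<close>.\<close>
      have "[wsum m = int e - int a] (mod 2)"
      proof -
        obtain x where "wsum m = int (e - Suc a) + 1
            + 2 * (\<Sum>i=Suc a..<e. int (b i) * int (e - i)) + 4 * x"
          using S by (metis cong_iff_lin cong_sym)
        with ae have "wsum m = int e - int a
            + 2 * ((\<Sum>i=Suc a..<e. int (b i) * int (e - i)) + 2 * x)"
          by (simp add: of_nat_diff)
        then show ?thesis by (simp add: cong_iff_dvd_diff)
      qed
      then have "[4 * wsum m = 4 * (int e - int a)] (mod 4 * 2)"
        by (simp only: cong_iff_dvd_diff right_diff_distrib[symmetric] mult_dvd_mono dvd_refl)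
      then have "[2 * (int a div 2) + (2 + 4 * wsum m)
          = 2 * (int a div 2) + (2 + 4 * (int e - int a))] (mod 8)"
        by (intro cong_add cong_refl) simp
      with W False show ?thesis
        by (auto simp: add_ac intro: cong_trans)
    next
      case True
      then obtain h where h: "a = 2 * h" by blast
      \<comment> \<open>\<open>2 * c\<close> is \<open>e\<close> rounded up to an even number, so
        \<open>2 * c - 1\<close> equals \<open>e - \<chi>(e even)\<close> for both parities of
        \<open>e\<close>.\<close>
      define c where "c = (e + 1) div 2"
      have hc: "Suc h \<le> c" using ae by (simp add: c_def h)
      define U where "U = (\<Sum>i=2*h+2..<2*c. d (int i) * (int e - int i))"
      have "signed_sum (int a + 2) (int e - of_bool (even e)) d
          = signed_sum (int (2 * h + 2)) (int (2 * c) - 1) d"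
        by (cases "even e") (auto simp: h c_def add.commute elim!: evenE oddE)
      also have "\<dots> = (\<Sum>i=2*h+2..<2*c. d (int i))"
        using hc by (intro signed_sum_nat) simp
      finally have T1: "signed_sum (int a + 2) (int e - of_bool (even e)) d
          = (\<Sum>i=2*h+2..<2*c. d (int i))" .
      have "signed_sum ((int a + 4) div 2) ((int e + 1) div 2) (\<lambda>t. d (2 * t - 1))
          = signed_sum (int (Suc (h + 1))) (int (Suc c) - 1) (\<lambda>t. d (2 * t - 1))"
        by (simp add: h c_def zdiv_int add.commute)
      also have "\<dots> = (\<Sum>t=Suc (h+1)..<Suc c. d (2 * int t - 1))"
        using hc by (intro signed_sum_nat) simp
      also have "\<dots> = (\<Sum>t=h+1..<c. d (int (2 * t + 1)))"
        unfolding sum.atLeast_Suc_lessThan_Suc_shift by (simp add: algebra_simps)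
      finally have T2: "signed_sum ((int a + 4) div 2) ((int e + 1) div 2) (\<lambda>t. d (2 * t - 1))
          = (\<Sum>t=h+1..<c. d (int (2 * t + 1)))" .
      have "[U = ?T - int a * d (int a + 2)] (mod 2)"
        unfolding U_def T1 T2
        using digit_sum_parity[OF hc, of "\<lambda>i. d (int i)" "int e"] by simp
      moreover have "even (int a * d (int a + 2))" using True by simp
      ultimately have UT: "even (U - ?T)"
        by (simp add: cong_iff_dvd_diff)
      \<comment> \<open>For odd \<open>e\<close> the range of \<open>U\<close> also contains \<open>i = e\<close>, where the summand vanishes.\<close>
      have "U = (\<Sum>i=2*h+2..<e. d (int i) * (int e - int i))"
        unfolding U_def
        by (intro sum.mono_neutral_right) (auto simp: c_def)
      also have "\<dots> = (\<Sum>i=Suc (Suc a)..<e. int (b i) * int (e - i))"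
        by (intro sum.cong) (auto simp: h d of_nat_diff)
      finally have U: "U = (\<Sum>i=Suc (Suc a)..<e. int (b i) * int (e - i))" .
      define k where "k = int e - int a - 1"
      have "(\<Sum>i=Suc a..<e. int (b i) * int (e - i)) = int (b (Suc a)) * k + U"
      \<comment> \<open>The digit at \<open>a + 1\<close> is split off. If \<open>Suc a = e\<close>,
        the sum is empty and \<open>k = 0\<close>.\<close>
      proof (cases "Suc a < e")
        case True
        then show ?thesis
          by (simp add: U sum.atLeast_Suc_lessThan k_def of_nat_diff)
      next
        case False
        with ae show ?thesis by (simp add: U k_def)
      qed
      with S ae have "[wsum m = k + 1 + 2 * (d (int a + 1) * k + U)] (mod 4)"
        using d[of "Suc a"] by (simp add: k_def of_nat_diff add.commute)
      moreover have "[wint n = 2 * (int a div 2) + 2 * wsum m] (mod 8)"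
        using W True by simp
      ultimately have "[wint n = 2 + 2 * (int a div 2)
          + 2 * (1 - 2 * d (int a + 1)) * k + 4 * ?T] (mod 8)"
        using UT by (rule cong_mod8_combine)
      with True show ?thesis by (simp add: k_def)
    qed
  qed
qed

end
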